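(* Let $E$ be a subset of the Euclidean space $\mathbb R^n$ and $p\in\mathbb R^n$. Suppose that $E$ is $\alpha$-thin at the point $p$ for some $\alpha\in(1,n]$. Then there is a ray from $p$ that avoids $E$ at least within some small ball at $p$; that is, there are a unit vector $\theta\in S^{n-1}$ and $r>0$ such that $p+t\theta\notin E$ for all $0<t<r$.
   Context: Capacity. For a bounded open subset $\Omega\subseteq\mathbb R^n$ with diameter $D$, $\alpha\in(1,n]$, and a Radon measure $\mu$ on $\Omega$, put for $x\in\Omega$ $$R^{\alpha,\Omega}_\mu(x)=\int_\Omega\frac{1}{|x-y|^{n-\alpha}}\,d\mu(y)\ \text{ if }\alpha\in(1,n),\qquad R^{n,\Omega}_\mu(x)=\int_\Omega\log\frac{D}{|x-y|}\,d\mu(y)\ \text{ if }\alpha=n.$$ For $E\subseteq\Omega$ define $$C^\alpha(E,\Omega)=\inf\{\mu(\Omega):\ \mu\ge0\text{ a Radon measure on }\Omega,\ R^{\alpha,\Omega}_\mu(x)\ge1\text{ for all }x\in E\}.$$ Thinness. Let $\omega_i^\delta(p)=\{x\in\mathbb R^n:|x-p|\in[2^{-i}\delta,2^{-i+1}\delta]\}$ and $\Omega_i^\delta(p)=\{x\in\mathbb R^n:|x-p|\in(2^{-i-1}\delta,2^{-i+2}\delta)\}$. A subset $E\subseteq\mathbb R^n$ is $\alpha$-thin at $p$, for $\alpha\in(1,n)$, if for some small $\delta>0$ $$\sum_{i\ge1}\frac{C^\alpha(E\cap\omega_i^\delta(p),\Omega_i^\delta(p))}{C^\alpha(\partial B_{2^{-i}\delta}(p),B_{2^{-i+1}\delta}(p))}<\infty,$$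 and $E$ is $n$-thin at $p$ if for some small $\delta>0$ $$\sum_{i\ge1}i\,C^n(E\cap\omega_i^\delta(p),\Omega_i^\delta(p))<\infty.$$ *)

theory Defs
  imports "HOL-Analysis.Analysis"
begin

definition radon_measure_on :: "(real ^ 'n) set \<Rightarrow> (real ^ 'n) measure \<Rightarrow> bool" where
  "radon_measure_on \<Omega> \<mu> \<longleftrightarrow>
     sets \<mu> = sets (restrict_space borel \<Omega>) \<and>
     (\<forall>K. compact K \<and> K \<subseteq> \<Omega> \<longrightarrow> emeasure \<mu> K < \<infinity>) \<and>
     (\<forall>A\<in>sets \<mu>. emeasure \<mu> A = (SUP K\<in>{K. compact K \<and> K \<subseteq> A}. emeasure \<mu> K))"

text \<open>
  The value on the diagonal is infinite, as it must be for measures with atoms; it has to be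
  given explicitly because real division by zero would make it zero. For distinct \<open>x\<close>, \<open>y\<close> in
  the bounded set \<open>\<Omega>\<close> the logarithm is nonnegative, so the coercion to \<open>ennreal\<close>
  truncates nothing.
\<close>

definition riesz_kernel ::
    "real \<Rightarrow> (real ^ 'n) set \<Rightarrow> real ^ 'n \<Rightarrow> real ^ 'n \<Rightarrow> ennreal" where
  "riesz_kernel \<alpha> \<Omega> x y =
     (if x = y then \<infinity>
      else if \<alpha> = real CARD('n) then ennreal (ln (diameter \<Omega> / norm (x - y)))
      else ennreal (1 / norm (x - y) powr (real CARD('n) - \<alpha>)))"

definition riesz_potential ::
    "real \<Rightarrow> (real ^ 'n) set \<Rightarrow> (real ^ 'n) measure \<Rightarrow> real ^ 'n \<Rightarrow> ennreal" where
  "riesz_potential \<alpha> \<Omega> \<mu> x = (\<integral>\<^sup>+ y. riesz_kernel \<alpha> \<Omega> x y \<partial>\<mu>)"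

text \<open>
  Intended for \<open>\<Omega>\<close> bounded and open, \<open>E \<subseteq> \<Omega>\<close>, and \<open>\<alpha>\<close> in \<open>(1, n]\<close>;
  \<open>E\<close> need not be measurable.
\<close>

definition riesz_capacity :: "real \<Rightarrow> (real ^ 'n) set \<Rightarrow> (real ^ 'n) set \<Rightarrow> ennreal" where
  "riesz_capacity \<alpha> E \<Omega> =
     Inf {emeasure \<mu> \<Omega> | \<mu>.
            radon_measure_on \<Omega> \<mu> \<and> (\<forall>x\<in>E. 1 \<le> riesz_potential \<alpha> \<Omega> \<mu> x)}"

definition closed_shell :: "real \<Rightarrow> real ^ 'n \<Rightarrow> nat \<Rightarrow> (real ^ 'n) set" where
  "closed_shell \<delta> p i =
     {x. norm (x - p) \<in> {2 powi (- int i) * \<delta> .. 2 powi (- int i + 1) * \<delta>}}"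

definition open_shell :: "real \<Rightarrow> real ^ 'n \<Rightarrow> nat \<Rightarrow> (real ^ 'n) set" where
  "open_shell \<delta> p i =
     {x. norm (x - p) \<in> {2 powi (- int i - 1) * \<delta> <..< 2 powi (- int i + 2) * \<delta>}}"

definition thinness_term ::
    "real \<Rightarrow> (real ^ 'n) set \<Rightarrow> real ^ 'n \<Rightarrow> real \<Rightarrow> nat \<Rightarrow> ennreal" where
  "thinness_term \<alpha> E p \<delta> i =
     (if \<alpha> = real CARD('n)
      then of_nat i * riesz_capacity \<alpha> (E \<inter> closed_shell \<delta> p i) (open_shell \<delta> p i)
      else riesz_capacity \<alpha> (E \<inter> closed_shell \<delta> p i) (open_shell \<delta> p i) /
           riesz_capacity \<alpha> (frontier (ball p (2 powi (- int i) * \<delta>)))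
                            (ball p (2 powi (- int i + 1) * \<delta>)))"

text \<open>
  The series starts at \<open>i = 1\<close>, hence the shift by \<open>Suc\<close>. A series in \<open>ennreal\<close>
  always has a sum, so finiteness of the sum is convergence.
\<close>

definition thin_at :: "real \<Rightarrow> (real ^ 'n) set \<Rightarrow> real ^ 'n \<Rightarrow> bool" where
  "thin_at \<alpha> E p \<longleftrightarrow> (\<exists>\<delta>>0. (\<Sum>i. thinness_term \<alpha> E p \<delta> (Suc i)) < \<infinity>)"

end

theory Submission imports Defs begin

text \<open>
  Why thinness leaves a ray free. Fix a dyadic shell of radius comparable to \<open>\<rho>\<close> around \<open>p\<close>, a measure
  \<open>\<mu>\<close> whose potential is at least \<open>1\<close> on the part of \<open>E\<close> in the shell, and a direction \<open>\<theta>\<close> along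
  which the ray from \<open>p\<close> meets that part in a point \<open>p + t\<theta>\<close>. Radial projection to the
  unit sphere has Lipschitz constant of order \<open>1/\<rho>\<close> on the shell, so \<open>|p + t\<theta> - y|\<close> is at least \<open>\<rho>/2\<close> times the distance of \<open>\<theta>\<close> to the
  direction of \<open>y - p\<close>, whatever \<open>t\<close> is. Replacing the distance in the kernel by this lower bound
  removes the unknown \<open>t\<close> and gives a function of two directions, with a singularity of order
  \<open>s = n - \<alpha>\<close>, or a logarithmic one when \<open>\<alpha> = n\<close>. As \<open>\<alpha> > 1\<close>, the order is below \<open>n - 1\<close>, the dimension
  of the sphere of directions, so this function is integrable in \<open>\<theta>\<close>, uniformly in \<open>y\<close>
  (\<open>nn_integral_dyadic_kernel_bounded\<close>). By Tonelli and Markov the set of bad directions then has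
  outer measure at most a constant times \<open>\<rho>\<^sup>-\<^sup>s \<mu>(\<Omega>)\<close>; the infimum over \<open>\<mu>\<close> gives a bound by the
  capacity (\<open>outer_measure_directions_le_capacity\<close>).

  For \<open>\<alpha> < n\<close> the factor \<open>\<rho>\<^sup>-\<^sup>s\<close> is what the denominator in the definition of thinness supplies: a point
  mass \<open>\<rho>\<^sup>s\<close> at \<open>p\<close> has potential \<open>1\<close> on the sphere of radius \<open>\<rho>\<close>, so the capacity of the sphere is at
  most \<open>\<rho>\<^sup>s\<close> (\<open>riesz_capacity_sphere_le\<close>). For \<open>\<alpha> = n\<close> the factor is \<open>1\<close>, because the diameter in the
  logarithm makes that kernel invariant under scaling. Hence the measures of the sets of bad directions are
  bounded by the terms of a convergent series, and by the Borel--Cantelli lemma almost every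
  direction is bad in finitely many shells only. Any such direction is the one sought.

  Two devices keep the measure theory elementary. The measure on the sphere is the cone measure: a
  set of directions is represented by the points of the unit ball with these directions, measured by
  Lebesgue measure. The power \<open>d\<^sup>-\<^sup>s\<close>, with \<open>s = 1/2\<close> as a bound for the logarithm, is replaced by a
  sum of dyadic step functions above it, whose integral is a series of weighted volumes of cones.
\<close>

section \<open>Radial projection\<close>

lemma norm_scaleR_sgn: "norm a *\<^sub>R sgn a = (a :: 'a::real_normed_vector)"
  by (cases "a = 0") (simp_all add: sgn_div_norm)

text \<open>
  Moving \<open>b\<close> along its ray to the sphere through \<open>a\<close> costs \<open>|norm a - norm b|\<close>, which is itself at
  most \<open>norm (a - b)\<close>; hence the factor 2.
\<close>

lemma norm_sgn_diff_le:
  fixes a b :: "'a::real_normed_vector"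
  shows "norm a * norm (sgn a - sgn b) \<le> 2 * norm (a - b)"
proof -
  have "norm a *\<^sub>R (sgn a - sgn b) = (a - b) - (norm a - norm b) *\<^sub>R sgn b"
    by (simp add: algebra_simps norm_scaleR_sgn)
  moreover have "norm ((norm a - norm b) *\<^sub>R sgn b) \<le> norm (a - b)"
    using norm_triangle_ineq3[of a b] by (simp add: norm_sgn)
  moreover have "norm (norm a *\<^sub>R (sgn a - sgn b)) = norm a * norm (sgn a - sgn b)"
    by simp
  ultimately show ?thesis
    using norm_triangle_ineq4[of "a - b" "(norm a - norm b) *\<^sub>R sgn b"] by simp
qed

text \<open>
  The lower bound is independent of the position \<open>t\<close> on the ray. This lets the projected kernel
  dominate the potential at whichever point of the ray lies in the set.
\<close>

lemma norm_ray_diff_ge: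
  fixes \<theta> :: "'a::real_normed_vector"
  assumes "norm \<theta> = 1" "0 < \<rho>" "\<rho> \<le> t"
  shows "\<rho> / 2 * norm (\<theta> - sgn (y - p)) \<le> norm (p + t *\<^sub>R \<theta> - y)"
proof -
  have "\<rho> * norm (\<theta> - sgn (y - p)) \<le> t * norm (\<theta> - sgn (y - p))"
    using assms(3) by (intro mult_right_mono) auto
  also have "\<dots> \<le> 2 * norm (t *\<^sub>R \<theta> - (y - p))"
    using norm_sgn_diff_le[of "t *\<^sub>R \<theta>" "y - p"] assms
    by (simp add: sgn_scaleR sgn_div_norm[of \<theta>])
  also have "t *\<^sub>R \<theta> - (y - p) = p + t *\<^sub>R \<theta> - y"
    by simp
  finally show ?thesis
    by simp
qed

section \<open>A dyadic majorant of the inverse power\<close>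

text \<open>
  For \<open>0 < d \<le> 2\<close>, the range of distances between unit vectors, this sum is comparable to \<open>d\<^sup>-\<^sup>s\<close>
  when \<open>s > 0\<close>. Using the sum itself makes its integral a sum of measures of cones, and makes the
  kernel infinite on the diagonal, as it is for the potentials.
\<close>

definition dyadic_kernel :: "real \<Rightarrow> real \<Rightarrow> ennreal" where
  "dyadic_kernel s d = (\<Sum>k. ennreal (2 powr (s * real k)) * indicator {..2 / 2 ^ k} d)"

lemma dyadic_kernel_nonpos:
  assumes "0 \<le> s" "d \<le> 0"
  shows "dyadic_kernel s d = \<infinity>"
proof -
  have term_ge: "1 \<le> ennreal (2 powr (s * real k)) * indicator {..2 / 2 ^ k} d" for k
  proof -
    have "d \<le> 2 / 2 ^ k"
      using assms(2) by (rule order_trans) simp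
    then show ?thesis
      using assms(1) by (simp add: ge_one_powr_ge_zero)
  qed
  have "of_nat m \<le> dyadic_kernel s d" for m
  proof -
    have "of_nat m = (\<Sum>k<m. 1 :: ennreal)"
      by simp
    also have "\<dots> \<le> (\<Sum>k<m. ennreal (2 powr (s * real k)) * indicator {..2 / 2 ^ k} d)"
      by (intro sum_mono term_ge)
    also have "\<dots> \<le> dyadic_kernel s d"
      unfolding dyadic_kernel_def by (intro sum_le_suminf) auto
    finally show ?thesis .
  qed
  then have "\<not> dyadic_kernel s d < \<infinity>"
    using ennreal_Ex_less_of_nat[of "dyadic_kernel s d"] by (auto simp: not_le[symmetric])
  then show ?thesis
    by (simp add: less_top[symmetric])
qed

lemma powr_le_dyadic_kernel:
  assumes "0 \<le> s" "0 < d" "d \<le> 2"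
  shows "ennreal (d powr - s) \<le> dyadic_kernel s d"
proof -
  obtain n where "(1 / 2) ^ n < d / 2"
    using real_arch_pow_inv[of "d / 2" "1 / 2"] assms(2) by auto
  then have ex: "2 / 2 ^ n < d"
    by (simp add: power_divide)
  define m where "m = (LEAST n. 2 / 2 ^ n < d)"
  have m: "2 / 2 ^ m < d"
    unfolding m_def using ex by (rule LeastI)
  have "m \<noteq> 0"
    using m assms(3) by (cases m) auto
  then obtain k where k: "m = Suc k"
    using not0_implies_Suc by blast
  have "\<not> 2 / 2 ^ k < d"
    by (rule not_less_Least) (simp add: m_def[symmetric] k)
  then have up: "d \<le> 2 / 2 ^ k"
    by simp
  have "2 powr (- real k) = 2 / 2 ^ m"
    unfolding k by (simp add: powr_minus_divide powr_realpow)
  with m have "2 powr (- real k) < d"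
    by (simp only:)
  then have "d powr - s \<le> (2 powr (- real k)) powr - s"
    using assms by (intro powr_mono2') auto
  also have "\<dots> = 2 powr (s * real k)"
    by (simp add: powr_powr mult.commute)
  finally have "d powr - s \<le> 2 powr (s * real k)" .
  then have "ennreal (d powr - s) \<le> ennreal (2 powr (s * real k))"
    by (rule ennreal_leI)
  \<comment> \<open>The single layer with \<open>1 / 2 ^ k < d \<le> 2 / 2 ^ k\<close> already dominates the power.\<close>
  also have "\<dots> = (\<Sum>k\<in>{k}. ennreal (2 powr (s * real k)) * indicator {..2 / 2 ^ k} d)"
    using up by (simp add: indicator_def)
  also have "\<dots> \<le> dyadic_kernel s d"
    unfolding dyadic_kernel_def by (rule sum_le_suminf) auto
  finally show ?thesis .
qed

lemma measurable_sgn_euclidean [measurable]: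
  "(sgn :: 'a::euclidean_space \<Rightarrow> 'a) \<in> borel_measurable borel"
  unfolding sgn_div_norm[abs_def] by measurable

lemma measurable_dyadic_kernel [measurable]: "dyadic_kernel s \<in> borel_measurable borel"
  unfolding dyadic_kernel_def[abs_def] by measurable

section \<open>Integrability over directions\<close>

text \<open>
  A cone of aperture \<open>\<epsilon> = 2 / 2 ^ k\<close> about the axis \<open>w\<close> is covered by about \<open>1 / \<epsilon>\<close> balls of radius
  comparable to \<open>\<epsilon>\<close> centred on the axis, so its volume is of order \<open>\<epsilon> ^ (n - 1)\<close>. The axis may be any
  vector of norm at most 1, so that \<open>w = sgn (y - p)\<close> with \<open>y = p\<close> is covered as well.
\<close>

lemma emeasure_cone_le:
  fixes w :: "'a::euclidean_space"
  assumes "norm w \<le> 1"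
  shows "emeasure lborel {x \<in> ball 0 1. norm (sgn x - w) \<le> 2 / 2 ^ k}
           \<le> ennreal (2 * 3 ^ DIM('a) * unit_ball_vol DIM('a) * (2 ^ k / (2 ^ k) ^ DIM('a)))"
proof -
  let ?B = "\<lambda>j. cball ((real j / 2 ^ k) *\<^sub>R w) (3 / 2 ^ k)"
  have "{x \<in> ball 0 1. norm (sgn x - w) \<le> 2 / 2 ^ k} \<subseteq> (\<Union>j<2 ^ k. ?B j)"
  proof
    fix x assume "x \<in> {x \<in> ball 0 1. norm (sgn x - w) \<le> 2 / 2 ^ k}"
    then have x: "norm x < 1" "norm (sgn x - w) \<le> 2 / 2 ^ k"
      by auto
    define j where "j = nat \<lfloor>norm x * 2 ^ k\<rfloor>"
    have j: "real j \<le> norm x * 2 ^ k" "norm x * 2 ^ k < real j + 1"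
      unfolding j_def by (simp_all add: of_nat_nat)
    have "real j < real (2 ^ k)"
    proof -
      have "norm x * 2 ^ k < 1 * 2 ^ k"
        using x(1) by (intro mult_strict_right_mono) auto
      with j(1) show ?thesis
        unfolding of_nat_power of_nat_numeral by linarith
    qed
    then have "j < 2 ^ k"
      by (simp only: of_nat_less_iff)
    \<comment> \<open>The error is at most \<open>2 / 2 ^ k\<close> from the direction and \<open>1 / 2 ^ k\<close> from rounding the radius.\<close>
    have "(real j / 2 ^ k) *\<^sub>R w - x
            = - (norm x *\<^sub>R (sgn x - w)) - (norm x - real j / 2 ^ k) *\<^sub>R w"
      by (simp add: norm_scaleR_sgn algebra_simps)
    also have "norm \<dots> \<le> norm x * norm (sgn x - w) + \<bar>norm x - real j / 2 ^ k\<bar> * norm w"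
      by (rule order_trans[OF norm_triangle_ineq4]) simp
    also have "norm x * norm (sgn x - w) \<le> 1 * (2 / 2 ^ k)"
      using x by (intro mult_mono) auto
    also have "\<bar>norm x - real j / 2 ^ k\<bar> * norm w \<le> 1 / 2 ^ k * 1"
    proof (intro mult_mono)
      have "norm x - real j / 2 ^ k = (norm x * 2 ^ k - real j) / 2 ^ k"
        by (simp add: diff_divide_distrib)
      moreover have "\<bar>norm x * 2 ^ k - real j\<bar> \<le> 1"
        using j by linarith
      ultimately show "\<bar>norm x - real j / 2 ^ k\<bar> \<le> 1 / 2 ^ k"
        by (simp add: divide_right_mono)
    qed (use assms in auto)
    finally have "x \<in> ?B j"
      by (simp add: dist_norm)
    then show "x \<in> (\<Union>j<2 ^ k. ?B j)"
      using \<open>j < 2 ^ k\<close> by auto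
  qed
  then have "emeasure lborel {x \<in> ball 0 1. norm (sgn x - w) \<le> 2 / 2 ^ k}
               \<le> emeasure lborel (\<Union>j<(2::nat) ^ k. ?B j)"
    by (intro emeasure_mono) auto
  also have "\<dots> \<le> (\<Sum>j<(2::nat) ^ k. emeasure lborel (?B j))"
    by (intro emeasure_subadditive_finite) auto
  also have "\<dots> = (\<Sum>j<(2::nat) ^ k. ennreal (unit_ball_vol DIM('a) * (3 / 2 ^ k) ^ DIM('a)))"
    by (simp add: emeasure_cball)
  also have "\<dots> = ennreal (2 ^ k * (unit_ball_vol DIM('a) * (3 / 2 ^ k) ^ DIM('a)))"
    by (simp add: ennreal_mult ennreal_of_nat_eq_real_of_nat ennreal_power[symmetric])
  also have "\<dots> \<le> ennreal (2 * 3 ^ DIM('a) * unit_ball_vol DIM('a) * (2 ^ k / (2 ^ k) ^ DIM('a)))"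
    by (intro ennreal_leI) (simp add: power_divide field_simps)
  finally show ?thesis .
qed

text \<open>
  The \<open>k\<close>-th layer contributes \<open>2 ^ (s k)\<close> times a cone volume of order \<open>2 ^ (- (n - 1) k)\<close>. The
  resulting geometric series converges because \<open>s < n - 1\<close>; this is where \<open>\<alpha> > 1\<close> enters.
\<close>

lemma nn_integral_dyadic_kernel_bounded:
  assumes "0 \<le> s" "s < real DIM('a::euclidean_space) - 1"
  obtains C where "0 < C" and "\<And>w :: 'a. norm w \<le> 1 \<Longrightarrow>
    (\<integral>\<^sup>+ x. dyadic_kernel s (norm (sgn x - w)) * indicator (ball 0 1) x \<partial>lborel) \<le> ennreal C"
proof
  define c where "c = 2 * 3 ^ DIM('a) * unit_ball_vol DIM('a)"
  define q where "q = 2 powr (s + 1 - real DIM('a))"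
  have "0 < c"
    by (simp add: c_def)
  have "0 < q"
    by (simp add: q_def)
  have "q < 2 powr 0"
    unfolding q_def by (rule powr_less_mono) (use assms in auto)
  then have "q < 1" by simp
  show "0 < c / (1 - q)"
    using \<open>0 < c\<close> \<open>q < 1\<close> by simp
  fix w :: 'a assume w: "norm w \<le> 1"
  let ?S = "\<lambda>k. {x \<in> ball 0 1. norm (sgn x - w) \<le> 2 / 2 ^ k}"
  have [measurable]: "?S k \<in> sets borel" for k
    by measurable
  have "(\<integral>\<^sup>+ x. dyadic_kernel s (norm (sgn x - w)) * indicator (ball 0 1) x \<partial>lborel)
          = (\<integral>\<^sup>+ x. (\<Sum>k. ennreal (2 powr (s * real k)) * indicator (?S k) x) \<partial>lborel)"
    unfolding dyadic_kernel_def by (intro nn_integral_cong) (auto simp: indicator_def intro!: suminf_cong)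
  also have "\<dots> = (\<Sum>k. ennreal (2 powr (s * real k)) * emeasure lborel (?S k))"
    by (subst nn_integral_suminf) (auto simp: nn_integral_cmult_indicator)
  also have "\<dots> \<le> (\<Sum>k. ennreal (c * q ^ k))"
  proof (intro suminf_le)
    fix k
    have "ennreal (2 powr (s * real k)) * emeasure lborel (?S k)
        \<le> ennreal (2 powr (s * real k)) * ennreal (c * (2 ^ k / (2 ^ k) ^ DIM('a)))"
      unfolding c_def by (intro mult_left_mono emeasure_cone_le w) auto
    also have "\<dots> = ennreal (2 powr (s * real k) * (c * (2 ^ k / (2 ^ k) ^ DIM('a))))"
      by (rule ennreal_mult[symmetric]) (use \<open>0 < c\<close> in auto)
    also have "2 powr (s * real k) * (c * (2 ^ k / (2 ^ k) ^ DIM('a))) = c * q ^ k"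
    proof -
      have "q ^ k = 2 powr (s * real k + real k - real k * real DIM('a))"
        unfolding q_def by (simp add: powr_realpow[symmetric] powr_powr algebra_simps)
      also have "\<dots> = 2 powr (s * real k) * 2 ^ k / (2 ^ k) ^ DIM('a)"
        by (simp add: powr_diff powr_add powr_realpow power_mult[symmetric]
            flip: of_nat_mult)
      finally show ?thesis by simp
    qed
    finally show "ennreal (2 powr (s * real k)) * emeasure lborel (?S k) \<le> ennreal (c * q ^ k)" .
  qed auto
  also have "\<dots> = ennreal (c / (1 - q))"
  proof (rule suminf_ennreal_eq)
    show "(\<lambda>k. c * q ^ k) sums (c / (1 - q))"
      using sums_mult[OF geometric_sums[of q], of c] \<open>0 < q\<close> \<open>q < 1\<close> by simp
  qed (use \<open>0 < c\<close> \<open>0 < q\<close> in simp)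
  finally show "(\<integral>\<^sup>+ x. dyadic_kernel s (norm (sgn x - w)) * indicator (ball 0 1) x \<partial>lborel)
                  \<le> ennreal (c / (1 - q))" .
qed

text \<open>
  Markov's inequality for the projected potential, whose integral over directions is computed by
  exchanging the order of integration. An outer measure is used because \<open>A\<close> will come from a set
  that need not be measurable.
\<close>

lemma outer_measure_directions_le:
  fixes p :: "'a::euclidean_space" and \<mu> :: "'a measure" and A :: "'a set"
  assumes \<mu>: "sets \<mu> = sets (restrict_space borel \<Omega>)"
    and "0 < M" "0 < C" "A \<subseteq> ball 0 1"
    and C: "\<And>w :: 'a. norm w \<le> 1 \<Longrightarrow>
      (\<integral>\<^sup>+ x. dyadic_kernel s (norm (sgn x - w)) * indicator (ball 0 1) x \<partial>lborel) \<le> ennreal C"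
    and A: "\<And>x. x \<in> A \<Longrightarrow> 1 \<le> (\<integral>\<^sup>+ y. ennreal M * dyadic_kernel s (norm (sgn x - sgn (y - p))) \<partial>\<mu>)"
  shows "outer_measure_of lborel A \<le> ennreal (M * C) * emeasure \<mu> (space \<mu>)"
proof (cases "emeasure \<mu> (space \<mu>) = \<infinity>")
  case True
  then show ?thesis
    using assms by (simp add: ennreal_mult_top)
next
  case False
  then interpret \<mu>: finite_measure \<mu>
    by (intro finite_measureI) simp
  interpret pair_sigma_finite lborel \<mu> ..
  have "(\<lambda>y. sgn (y - p)) \<in> borel_measurable (restrict_space borel \<Omega>)"
    by (rule measurable_restrict_space1) measurable
  then have [measurable]: "(\<lambda>y. sgn (y - p)) \<in> borel_measurable \<mu>"
    using measurable_cong_sets[OF \<mu> refl] by blast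
  define u where "u x = (\<integral>\<^sup>+ y. dyadic_kernel s (norm (sgn x - sgn (y - p))) \<partial>\<mu>)" for x
  have u_measurable [measurable]: "u \<in> borel_measurable lborel"
    unfolding u_def by measurable
  have "(\<lambda>z. sgn (snd z - p)) \<in> borel_measurable (lborel \<Otimes>\<^sub>M \<mu>)"
    by (rule measurable_compose[OF measurable_snd]) measurable
  moreover have "(\<lambda>z. sgn (fst z)) \<in> borel_measurable (lborel \<Otimes>\<^sub>M \<mu>)"
    by (rule measurable_compose[OF measurable_fst]) simp
  moreover have "(\<lambda>z. indicator (ball 0 1) (fst z) :: ennreal) \<in> borel_measurable (lborel \<Otimes>\<^sub>M \<mu>)"
    by (rule measurable_compose[OF measurable_fst]) (simp add: borel_measurable_indicator)
  ultimately have joint: "(\<lambda>(x, y). dyadic_kernel s (norm (sgn x - sgn (y - p))) * indicator (ball 0 1) x)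
      \<in> borel_measurable (lborel \<Otimes>\<^sub>M \<mu>)"
    unfolding case_prod_beta
    by (intro borel_measurable_times_ennreal measurable_compose[OF _ measurable_dyadic_kernel]
        measurable_compose[OF _ borel_measurable_norm] borel_measurable_diff)
  have "(\<integral>\<^sup>+ x. u x * indicator (ball 0 1) x \<partial>lborel)
      = (\<integral>\<^sup>+ x. (\<integral>\<^sup>+ y. dyadic_kernel s (norm (sgn x - sgn (y - p))) * indicator (ball 0 1) x \<partial>\<mu>) \<partial>lborel)"
    by (simp add: u_def nn_integral_multc)
  also have "\<dots> = (\<integral>\<^sup>+ y. (\<integral>\<^sup>+ x. dyadic_kernel s (norm (sgn x - sgn (y - p))) * indicator (ball 0 1) x \<partial>lborel) \<partial>\<mu>)"
    by (rule Fubini'[OF joint, symmetric])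
  also have "\<dots> \<le> (\<integral>\<^sup>+ y. ennreal C \<partial>\<mu>)"
    by (rule nn_integral_mono, rule C) (simp add: norm_sgn)
  also have "\<dots> = ennreal C * emeasure \<mu> (space \<mu>)"
    by simp
  finally have integral_u: "(\<integral>\<^sup>+ x. u x * indicator (ball 0 1) x \<partial>lborel) \<le> ennreal C * emeasure \<mu> (space \<mu>)" .
  have "A \<subseteq> {x \<in> ball 0 1. 1 \<le> ennreal M * u x}"
    using A assms(4) by (auto simp: u_def nn_integral_cmult)
  then have "outer_measure_of lborel A \<le> outer_measure_of lborel {x \<in> ball 0 1. 1 \<le> ennreal M * u x}"
    by (rule outer_measure_of_mono)
  also have "\<dots> = emeasure lborel {x \<in> ball 0 1. 1 \<le> ennreal M * u x}"
    by (rule outer_measure_of_eq) measurable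
  also have "\<dots> \<le> ennreal M * (\<integral>\<^sup>+ x. u x * indicator (ball 0 1) x \<partial>lborel)"
    by (intro nn_integral_Markov_inequality borel_measurable_times_ennreal
        u_measurable borel_measurable_indicator) auto
  also have "\<dots> \<le> ennreal M * (ennreal C * emeasure \<mu> (space \<mu>))"
    by (intro mult_left_mono integral_u) simp
  also have "\<dots> = ennreal (M * C) * emeasure \<mu> (space \<mu>)"
    using assms(2,3) by (simp add: ennreal_mult mult.assoc)
  finally show ?thesis .
qed

section \<open>Comparison of the kernels\<close>

lemma riesz_kernel_le_dyadic_kernel:
  fixes p y \<theta> :: "real ^ 'n"
  assumes "norm \<theta> = 1" "0 < \<rho>" "\<rho> \<le> t" "\<alpha> < real CARD('n)"
  shows "riesz_kernel \<alpha> \<Omega> (p + t *\<^sub>R \<theta>) y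
    \<le> ennreal ((\<rho> / 2) powr (\<alpha> - real CARD('n)))
       * dyadic_kernel (real CARD('n) - \<alpha>) (norm (\<theta> - sgn (y - p)))"
    (is "_ \<le> ennreal ?M * dyadic_kernel ?s ?d")
proof (cases "?d = 0")
  case True
  then show ?thesis
    using assms by (simp add: dyadic_kernel_nonpos ennreal_mult_top)
next
  case False
  note dist = norm_ray_diff_ge[OF assms(1-3), of y p]
  have d: "0 < ?d" "?d \<le> 2"
    using False norm_triangle_ineq4[of \<theta> "sgn (y - p)"] assms(1)
    by (simp_all add: norm_sgn split: if_splits)
  have pos: "0 < \<rho> / 2 * ?d"
    using assms(2) d(1) by simp
  have ne: "p + t *\<^sub>R \<theta> \<noteq> y"
    using dist pos by auto
  have "1 / norm (p + t *\<^sub>R \<theta> - y) powr ?s = norm (p + t *\<^sub>R \<theta> - y) powr - ?s"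
    by (rule powr_minus_divide[symmetric])
  also have "\<dots> \<le> (\<rho> / 2 * ?d) powr - ?s"
    using dist pos assms(4) by (intro powr_mono2') auto
  also have "\<dots> = ?M * ?d powr - ?s"
    using assms(2) d(1) by (subst powr_mult) auto
  finally have "riesz_kernel \<alpha> \<Omega> (p + t *\<^sub>R \<theta>) y \<le> ennreal (?M * ?d powr - ?s)"
    using ne assms(4) by (simp add: riesz_kernel_def ennreal_leI)
  also have "\<dots> = ennreal ?M * ennreal (?d powr - ?s)"
    by (rule ennreal_mult) auto
  also have "\<dots> \<le> ennreal ?M * dyadic_kernel ?s ?d"
    using assms(4) d by (intro mult_left_mono powr_le_dyadic_kernel) auto
  finally show ?thesis .
qed

text \<open>
  The diameter is comparable to \<open>\<rho>\<close>, so the scale cancels and the kernel is at most \<open>ln (16 / d)\<close>,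
  with \<open>d\<close> the distance of the directions. A logarithm is below any power; the exponent \<open>1 / 2\<close>
  is chosen because it is below \<open>n - 1\<close> for every \<open>n \<ge> 2\<close>.
\<close>

lemma log_kernel_le_dyadic_kernel:
  fixes p y \<theta> :: "real ^ 'n"
  assumes "norm \<theta> = 1" "0 < \<rho>" "\<rho> \<le> t" "diameter \<Omega> \<le> 8 * \<rho>" "bounded \<Omega>"
  shows "riesz_kernel (real CARD('n)) \<Omega> (p + t *\<^sub>R \<theta>) y
    \<le> ennreal 8 * dyadic_kernel (1 / 2) (norm (\<theta> - sgn (y - p)))"
    (is "_ \<le> _ * dyadic_kernel _ ?d")
proof (cases "?d = 0")
  case True
  then show ?thesis
    by (simp add: dyadic_kernel_nonpos ennreal_mult_top)
next
  case False
  note dist = norm_ray_diff_ge[OF assms(1-3), of y p]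
  have d: "0 < ?d" "?d \<le> 2"
    using False norm_triangle_ineq4[of \<theta> "sgn (y - p)"] assms(1)
    by (simp_all add: norm_sgn split: if_splits)
  have pos: "0 < \<rho> / 2 * ?d"
    using assms(2) d(1) by simp
  have ne: "p + t *\<^sub>R \<theta> \<noteq> y"
    using dist pos by auto
  have "diameter \<Omega> / norm (p + t *\<^sub>R \<theta> - y) \<le> (8 * \<rho>) / (\<rho> / 2 * ?d)"
    using dist pos assms(2,4) by (intro frac_le) auto
  also have "\<dots> = 16 / ?d"
    using assms(2) by simp
  finally have quot: "diameter \<Omega> / norm (p + t *\<^sub>R \<theta> - y) \<le> 16 / ?d" .
  have "ln (diameter \<Omega> / norm (p + t *\<^sub>R \<theta> - y)) \<le> ln (16 / ?d)"
  proof (cases "diameter \<Omega> = 0")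
    case True
    then show ?thesis
      using d by (simp add: ln_ge_zero)
  next
    case False
    then have "0 < diameter \<Omega>"
      using diameter_ge_0[OF assms(5)] by simp
    then show ?thesis
      using quot ne by (intro ln_mono) auto
  qed
  also have "\<dots> \<le> (16 / ?d) powr (1 / 2) / (1 / 2)"
    using d by (intro ln_powr_bound) (auto simp: field_simps)
  also have "(16 / ?d) powr (1 / 2) = 4 * ?d powr - (1 / 2)"
  proof -
    have "(16 :: real) powr (1 / 2) = 4"
      by (simp add: powr_half_sqrt real_sqrt_eq_iff real_sqrt_unique)
    then show ?thesis
      by (simp add: powr_divide powr_minus_divide)
  qed
  finally have "riesz_kernel (real CARD('n)) \<Omega> (p + t *\<^sub>R \<theta>) y \<le> ennreal (8 * ?d powr - (1 / 2))"
    using ne by (simp add: riesz_kernel_def ennreal_leI)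
  also have "\<dots> = ennreal 8 * ennreal (?d powr - (1 / 2))"
    by (rule ennreal_mult) auto
  also have "\<dots> \<le> ennreal 8 * dyadic_kernel (1 / 2) ?d"
    using d by (intro mult_left_mono powr_le_dyadic_kernel) auto
  finally show ?thesis .
qed

section \<open>Bad directions and capacity\<close>

lemma outer_measure_directions_le_capacity:
  fixes p :: "real ^ 'n"
  assumes "0 < M" "0 < C" "A \<subseteq> ball 0 1"
    and C: "\<And>w :: real ^ 'n. norm w \<le> 1 \<Longrightarrow>
      (\<integral>\<^sup>+ x. dyadic_kernel s (norm (sgn x - w)) * indicator (ball 0 1) x \<partial>lborel) \<le> ennreal C"
    and A: "\<And>x. x \<in> A \<Longrightarrow> \<exists>e\<in>E. \<forall>y. riesz_kernel \<alpha> \<Omega> e y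
                               \<le> ennreal M * dyadic_kernel s (norm (sgn x - sgn (y - p)))"
  shows "outer_measure_of lborel A \<le> ennreal (M * C) * riesz_capacity \<alpha> E \<Omega>"
proof -
  let ?c = "ennreal (M * C)"
  have c: "0 < ?c" "?c \<noteq> 0" "?c \<noteq> top"
    using assms(1,2) by auto
  have "outer_measure_of lborel A / ?c \<le> riesz_capacity \<alpha> E \<Omega>"
    unfolding riesz_capacity_def
  proof (rule Inf_greatest, clarify)
    fix \<mu> :: "(real ^ 'n) measure"
    assume \<mu>: "radon_measure_on \<Omega> \<mu>" "\<forall>x\<in>E. 1 \<le> riesz_potential \<alpha> \<Omega> \<mu> x"
    have sets: "sets \<mu> = sets (restrict_space borel \<Omega>)"
      using \<mu>(1) by (simp add: radon_measure_on_def)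
    have space: "space \<mu> = \<Omega>"
      using sets_eq_imp_space_eq[OF sets] by (simp add: space_restrict_space)
    have "outer_measure_of lborel A \<le> ?c * emeasure \<mu> (space \<mu>)"
    proof (rule outer_measure_directions_le[OF sets assms(1-3) C])
      fix x assume "x \<in> A"
      then obtain e where e: "e \<in> E" "\<And>y. riesz_kernel \<alpha> \<Omega> e y
          \<le> ennreal M * dyadic_kernel s (norm (sgn x - sgn (y - p)))"
        using A by blast
      have "1 \<le> riesz_potential \<alpha> \<Omega> \<mu> e"
        using \<mu>(2) e(1) by blast
      also have "\<dots> \<le> (\<integral>\<^sup>+ y. ennreal M * dyadic_kernel s (norm (sgn x - sgn (y - p))) \<partial>\<mu>)"
        unfolding riesz_potential_def by (rule nn_integral_mono) (rule e(2))
      finally show "1 \<le> (\<integral>\<^sup>+ y. ennreal M * dyadic_kernel s (norm (sgn x - sgn (y - p))) \<partial>\<mu>)" .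
    qed
    then show "outer_measure_of lborel A / ?c \<le> emeasure \<mu> \<Omega>"
      using c(1) space by (intro divide_le_posI_ennreal) auto
  qed
  then have "?c * (outer_measure_of lborel A / ?c) \<le> ?c * riesz_capacity \<alpha> E \<Omega>"
    by (rule mult_left_mono) simp
  then show ?thesis
    using c(2,3) mult_divide_eq_ennreal[of ?c "outer_measure_of lborel A"]
    by (simp add: ennreal_times_divide mult.commute)
qed

text \<open>
  The point mass at the centre is an admissible measure, since the kernel is constant on the sphere.
  It is built as the image of a weighted point measure so as to live on the Borel sets of the ball.
\<close>

lemma riesz_capacity_sphere_le:
  fixes p :: "real ^ 'n"
  assumes "0 < \<rho>" "0 < R" "\<alpha> \<noteq> real CARD('n)"
  shows "riesz_capacity \<alpha> (frontier (ball p \<rho>)) (ball p R)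
           \<le> ennreal (\<rho> powr (real CARD('n) - \<alpha>))"
proof -
  define c where "c = ennreal (\<rho> powr (real CARD('n) - \<alpha>))"
  define \<mu> where "\<mu> = distr (point_measure {p} (\<lambda>_. c)) (restrict_space borel (ball p R)) (\<lambda>y. y)"
  have p: "p \<in> ball p R"
    using assms(2) by simp
  have space: "space (restrict_space borel (ball p R)) = ball p R"
    by (simp add: space_restrict_space)
  have id: "(\<lambda>y. y) \<in> measurable (point_measure {p} (\<lambda>_. c)) (restrict_space borel (ball p R))"
    using p space by simp
  have sets: "sets \<mu> = sets (restrict_space borel (ball p R))"
    by (simp add: \<mu>_def)
  have \<mu>: "emeasure \<mu> A = (if p \<in> A then c else 0)" if "A \<in> sets \<mu>" for A
  proof -
    have "emeasure \<mu> A = emeasure (point_measure {p} (\<lambda>_. c)) (A \<inter> {p})"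
      using that sets id unfolding \<mu>_def by (simp add: emeasure_distr space_point_measure)
    also have "\<dots> = (\<Sum>a\<in>A \<inter> {p}. c)"
      by (rule emeasure_point_measure_finite) auto
    finally show ?thesis by simp
  qed
  have borel_sub: "A \<in> sets \<mu>" if "A \<in> sets borel" "A \<subseteq> ball p R" for A
    using that by (simp add: sets sets_restrict_space_iff)
  have finite: "emeasure \<mu> A < \<infinity>" for A
    by (cases "A \<in> sets \<mu>") (auto simp: \<mu> emeasure_notin_sets c_def)
  have "radon_measure_on (ball p R) \<mu>"
    unfolding radon_measure_on_def
  proof (intro conjI ballI allI impI)
    fix A assume A: "A \<in> sets \<mu>"
    have le: "emeasure \<mu> K \<le> emeasure \<mu> A" if "K \<subseteq> A" for K
      using A that by (intro emeasure_mono) auto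
    show "emeasure \<mu> A = (SUP K\<in>{K. compact K \<and> K \<subseteq> A}. emeasure \<mu> K)"
    proof (rule antisym)
      show "(SUP K\<in>{K. compact K \<and> K \<subseteq> A}. emeasure \<mu> K) \<le> emeasure \<mu> A"
        using le by (intro SUP_least) auto
      show "emeasure \<mu> A \<le> (SUP K\<in>{K. compact K \<and> K \<subseteq> A}. emeasure \<mu> K)"
      proof (cases "p \<in> A")
        case True
        have "emeasure \<mu> A = emeasure \<mu> {p}"
          using True A p by (simp add: \<mu> borel_sub)
        also have "\<dots> \<le> (SUP K\<in>{K. compact K \<and> K \<subseteq> A}. emeasure \<mu> K)"
          using True by (intro SUP_upper) auto
        finally show ?thesis .
      qed (simp add: \<mu> A)
    qed
  qed (use sets finite in auto)
  moreover have "1 \<le> riesz_potential \<alpha> (ball p R) \<mu> x" if "x \<in> frontier (ball p \<rho>)" for x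
  proof -
    have x: "norm (x - p) = \<rho>"
      using that assms(1) by (simp add: frontier_ball dist_norm norm_minus_commute)
    have sp: "{p} \<in> sets \<mu>"
      using p by (intro borel_sub) auto
    have "1 = ennreal (1 / \<rho> powr (real CARD('n) - \<alpha>)) * c"
      using assms(1) unfolding c_def by (subst ennreal_mult[symmetric]) auto
    also have "\<dots> = riesz_kernel \<alpha> (ball p R) x p * emeasure \<mu> {p}"
      using x assms(1,3) sp by (auto simp: riesz_kernel_def \<mu>)
    also have "\<dots> = (\<integral>\<^sup>+ y. riesz_kernel \<alpha> (ball p R) x p * indicator {p} y \<partial>\<mu>)"
      using sp by (simp add: nn_integral_cmult_indicator)
    also have "\<dots> \<le> riesz_potential \<alpha> (ball p R) \<mu> x"
      unfolding riesz_potential_def by (intro nn_integral_mono) (auto split: split_indicator)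
    finally show ?thesis .
  qed
  ultimately have "riesz_capacity \<alpha> (frontier (ball p \<rho>)) (ball p R) \<le> emeasure \<mu> (ball p R)"
    unfolding riesz_capacity_def by (intro Inf_lower) blast
  also have "\<dots> = c"
    using p by (simp add: \<mu> borel_sub)
  finally show ?thesis
    by (simp add: c_def)
qed

text \<open>
  The directions of rays from \<open>p\<close> that meet \<open>E\<close> at a distance between \<open>\<rho>\<close> and \<open>2 \<rho>\<close>, each represented
  by all points of the punctured unit ball in that direction, so that Lebesgue measure applies.
\<close>

definition cone_directions :: "(real ^ 'n) set \<Rightarrow> real ^ 'n \<Rightarrow> real \<Rightarrow> (real ^ 'n) set" where
  "cone_directions E p \<rho> = {x \<in> ball 0 1 - {0}. \<exists>t\<in>{\<rho>..2 * \<rho>}. p + t *\<^sub>R sgn x \<in> E}"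

lemma closed_shell_eq:
  "closed_shell \<delta> p i = {x. norm (x - p) \<in> {2 powi (- int i) * \<delta> .. 2 * (2 powi (- int i) * \<delta>)}}"
  using power_int_add[of "2 :: real" "- int i" 1] by (simp add: closed_shell_def mult_ac)

lemma diameter_open_shell_le:
  fixes p :: "real ^ 'n"
  assumes "0 < \<delta>"
  shows "diameter (open_shell \<delta> p i) \<le> 8 * (2 powi (- int i) * \<delta>)"
proof (rule diameter_le)
  fix x y assume "x \<in> open_shell \<delta> p i" "y \<in> open_shell \<delta> p i"
  then have "norm (x - p) < 4 * (2 powi (- int i) * \<delta>)" "norm (y - p) < 4 * (2 powi (- int i) * \<delta>)"
    using power_int_add[of "2 :: real" "- int i" 2] by (auto simp: open_shell_def)
  then show "norm (x - y) \<le> 8 * (2 powi (- int i) * \<delta>)"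
    using norm_triangle_ineq4[of "x - p" "y - p"] by simp
qed (use assms in simp)

lemma bounded_open_shell: "bounded (open_shell \<delta> p i)"
proof (rule bounded_subset)
  show "open_shell \<delta> p i \<subseteq> ball p (2 powi (- int i + 2) * \<delta>)"
    by (auto simp: open_shell_def dist_norm norm_minus_commute)
qed simp

lemma cone_directions_obtain:
  assumes "x \<in> cone_directions E p (2 powi (- int i) * \<delta>)"
  obtains t where "norm (sgn x) = 1" "2 powi (- int i) * \<delta> \<le> t"
    "0 < \<delta> \<Longrightarrow> p + t *\<^sub>R sgn x \<in> E \<inter> closed_shell \<delta> p i"
proof -
  from assms obtain t where t: "t \<in> {2 powi (- int i) * \<delta> .. 2 * (2 powi (- int i) * \<delta>)}"
      "p + t *\<^sub>R sgn x \<in> E" "x \<noteq> 0"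
    unfolding cone_directions_def by blast
  show thesis
  proof
    show "norm (sgn x) = 1"
      using t(3) by (simp add: norm_sgn)
    show "2 powi (- int i) * \<delta> \<le> t"
      using t(1) by simp
    show "p + t *\<^sub>R sgn x \<in> E \<inter> closed_shell \<delta> p i" if "0 < \<delta>"
    proof -
      have "0 < 2 powi (- int i) * \<delta>"
        using that by simp
      then have "0 < t"
        using t(1) by (simp only: atLeastAtMost_iff) linarith
      then show ?thesis
        using t by (simp add: closed_shell_eq norm_sgn)
    qed
  qed
qed

lemma divide_left_antimono_ennreal:
  fixes a b c :: ennreal
  assumes "b \<le> c" "c \<noteq> \<infinity>"
  shows "a / c \<le> a / b"
proof (cases "b = 0")
  case False
  have "b \<noteq> top"
    using assms by (auto simp: top_unique)
  then have "a = b * a / b"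
    using False mult_divide_eq_ennreal[of b a] by (simp add: mult.commute)
  also have "\<dots> \<le> c * (a / b)"
    using assms(1) by (simp add: ennreal_times_divide[symmetric] mult_right_mono)
  finally show ?thesis
    using False assms(1) by (intro divide_le_posI_ennreal) (auto simp: zero_less_iff_neq_zero)
qed simp

text \<open>
  The comparison constant of the kernels scales like \<open>\<rho> powr - s\<close>, and the capacity of the sphere in
  the denominator of the term is at most \<open>\<rho> powr s\<close>, so the scale cancels and \<open>C\<close> depends on \<open>\<alpha>\<close> and
  the dimension only. The logarithmic kernel, normalised by the diameter, has no scale to cancel.
\<close>

lemma outer_measure_cone_directions_le_thinness_term:
  assumes "1 < \<alpha>" "\<alpha> \<le> real CARD('n)"
  obtains C where "\<And>(E :: (real ^ 'n) set) p \<delta> i. 0 < \<delta> \<Longrightarrow> 0 < i \<Longrightarrow>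
    outer_measure_of lborel (cone_directions E p (2 powi (- int i) * \<delta>))
      \<le> ennreal C * thinness_term \<alpha> E p \<delta> i"
proof (cases "\<alpha> = real CARD('n)")
  case True
  have "2 \<le> CARD('n)"
    using assms by simp
  then have "2 \<le> real CARD('n)"
    by simp
  then have "1 / 2 < real DIM(real ^ 'n) - 1"
    by simp
  then obtain C where C: "0 < C" "\<And>w :: real ^ 'n. norm w \<le> 1 \<Longrightarrow>
      (\<integral>\<^sup>+ x. dyadic_kernel (1 / 2) (norm (sgn x - w)) * indicator (ball 0 1) x \<partial>lborel) \<le> ennreal C"
    using nn_integral_dyadic_kernel_bounded[where 'a = "real ^ 'n", of "1 / 2"] by auto
  show thesis
  proof
    fix E :: "(real ^ 'n) set" and p :: "real ^ 'n" and \<delta> :: real and i :: nat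
    assume "0 < \<delta>" "0 < i"
    let ?\<rho> = "2 powi (- int i) * \<delta>"
    let ?cap = "riesz_capacity \<alpha> (E \<inter> closed_shell \<delta> p i) (open_shell \<delta> p i)"
    have "outer_measure_of lborel (cone_directions E p ?\<rho>) \<le> ennreal (8 * C) * ?cap"
    proof (rule outer_measure_directions_le_capacity[OF _ C(1) _ C(2)])
      fix x assume "x \<in> cone_directions E p ?\<rho>"
      then obtain t where t: "norm (sgn x) = 1" "?\<rho> \<le> t" "p + t *\<^sub>R sgn x \<in> E \<inter> closed_shell \<delta> p i"
        using cone_directions_obtain \<open>0 < \<delta>\<close> by metis
      have "0 < ?\<rho>"
        using \<open>0 < \<delta>\<close> by simp
      then have "riesz_kernel \<alpha> (open_shell \<delta> p i) (p + t *\<^sub>R sgn x) y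
          \<le> ennreal 8 * dyadic_kernel (1 / 2) (norm (sgn x - sgn (y - p)))" for y
        unfolding True
        by (rule log_kernel_le_dyadic_kernel[OF t(1) _ t(2) diameter_open_shell_le[OF \<open>0 < \<delta>\<close>]
              bounded_open_shell])
      then show "\<exists>e\<in>E \<inter> closed_shell \<delta> p i. \<forall>y. riesz_kernel \<alpha> (open_shell \<delta> p i) e y
              \<le> ennreal 8 * dyadic_kernel (1 / 2) (norm (sgn x - sgn (y - p)))"
        using t(3) by blast
    qed (auto simp: cone_directions_def)
    also have "?cap \<le> of_nat i * ?cap"
      using \<open>0 < i\<close> mult_right_mono[OF of_nat_mono[of 1 i], of ?cap] by simp
    finally show "outer_measure_of lborel (cone_directions E p ?\<rho>)
                    \<le> ennreal (8 * C) * thinness_term \<alpha> E p \<delta> i"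
      by (simp add: thinness_term_def True mult_left_mono)
  qed
next
  case False
  define s where "s = real CARD('n) - \<alpha>"
  have s: "0 < s" "s < real DIM(real ^ 'n) - 1"
    using False assms by (auto simp: s_def)
  then obtain C where C: "0 < C" "\<And>w :: real ^ 'n. norm w \<le> 1 \<Longrightarrow>
      (\<integral>\<^sup>+ x. dyadic_kernel s (norm (sgn x - w)) * indicator (ball 0 1) x \<partial>lborel) \<le> ennreal C"
    using nn_integral_dyadic_kernel_bounded[where 'a = "real ^ 'n", of s] by auto
  show thesis
  proof
    fix E :: "(real ^ 'n) set" and p :: "real ^ 'n" and \<delta> :: real and i :: nat
    assume "0 < \<delta>" "0 < i"
    define \<rho> where "\<rho> = 2 powi (- int i) * \<delta>"
    have "0 < \<rho>"
      using \<open>0 < \<delta>\<close> by (simp add: \<rho>_def)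
    let ?cap = "riesz_capacity \<alpha> (E \<inter> closed_shell \<delta> p i) (open_shell \<delta> p i)"
    let ?sph = "riesz_capacity \<alpha> (frontier (ball p \<rho>)) (ball p (2 powi (- int i + 1) * \<delta>))"
    have "outer_measure_of lborel (cone_directions E p \<rho>) \<le> ennreal ((\<rho> / 2) powr - s * C) * ?cap"
    proof (rule outer_measure_directions_le_capacity[OF _ C(1) _ C(2)])
      fix x assume "x \<in> cone_directions E p \<rho>"
      then obtain t where t: "norm (sgn x) = 1" "\<rho> \<le> t" "p + t *\<^sub>R sgn x \<in> E \<inter> closed_shell \<delta> p i"
        using cone_directions_obtain \<open>0 < \<delta>\<close> unfolding \<rho>_def by metis
      have "riesz_kernel \<alpha> (open_shell \<delta> p i) (p + t *\<^sub>R sgn x) y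
          \<le> ennreal ((\<rho> / 2) powr - s) * dyadic_kernel s (norm (sgn x - sgn (y - p)))" for y
        using riesz_kernel_le_dyadic_kernel[OF t(1) \<open>0 < \<rho>\<close> t(2), of \<alpha> _ p] s(1)
        by (simp add: s_def)
      then show "\<exists>e\<in>E \<inter> closed_shell \<delta> p i. \<forall>y. riesz_kernel \<alpha> (open_shell \<delta> p i) e y
              \<le> ennreal ((\<rho> / 2) powr - s) * dyadic_kernel s (norm (sgn x - sgn (y - p)))"
        using t(3) by blast
    qed (use \<open>0 < \<rho>\<close> in \<open>auto simp: cone_directions_def\<close>)
    also have "(\<rho> / 2) powr - s * C = 2 powr s * C * (1 / \<rho> powr s)"
      using \<open>0 < \<rho>\<close> by (simp add: powr_divide powr_minus_divide)
    also have "ennreal (2 powr s * C * (1 / \<rho> powr s)) = ennreal (2 powr s * C) * (1 / ennreal (\<rho> powr s))"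
      using \<open>0 < \<rho>\<close> C(1) divide_ennreal[of 1 "\<rho> powr s"] by (subst ennreal_mult) auto
    also have "ennreal (2 powr s * C) * (1 / ennreal (\<rho> powr s)) * ?cap
        = ennreal (2 powr s * C) * (?cap / ennreal (\<rho> powr s))"
      by (simp add: ennreal_times_divide ennreal_divide_times mult.assoc)
    also have "\<dots> \<le> ennreal (2 powr s * C) * (?cap / ?sph)"
    proof (intro mult_left_mono divide_left_antimono_ennreal)
      show "?sph \<le> ennreal (\<rho> powr s)"
        unfolding s_def using \<open>0 < \<rho>\<close> \<open>0 < \<delta>\<close> False by (intro riesz_capacity_sphere_le) auto
    qed auto
    finally show "outer_measure_of lborel (cone_directions E p (2 powi (- int i) * \<delta>))
                    \<le> ennreal (2 powr s * C) * thinness_term \<alpha> E p \<delta> i"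
      using False by (simp add: thinness_term_def \<rho>_def)
  qed
qed

section \<open>A ray that avoids the set\<close>

lemma dyadic_interval_exists:
  fixes t \<delta> :: real
  assumes "0 < t" "t \<le> 2 powi (- int N) * \<delta>"
  obtains i where "N < i" "t \<in> {2 powi (- int i) * \<delta> .. 2 * (2 powi (- int i) * \<delta>)}"
proof -
  define f where "f i = 2 powi (- int i) * \<delta>" for i
  have "0 < \<delta>"
  proof (rule ccontr)
    assume "\<not> 0 < \<delta>"
    then have "2 powi (- int N) * \<delta> \<le> 0"
      by (intro mult_nonneg_nonpos) auto
    with assms show False by linarith
  qed
  have Suc: "f i = 2 * f (Suc i)" for i
    using power_int_add[of "2 :: real" "- int (Suc i)" 1] by (simp add: f_def)
  obtain n where "(1 / 2) ^ n < t / \<delta>"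
    using real_arch_pow_inv[of "t / \<delta>" "1 / 2"] assms \<open>0 < \<delta>\<close> by auto
  moreover have "f n = (1 / 2) ^ n * \<delta>"
    by (simp add: f_def power_int_minus power_one_over inverse_eq_divide)
  ultimately have "f n < t"
    using \<open>0 < \<delta>\<close> by (simp only: pos_less_divide_eq)
  define m where "m = (LEAST n. f n < t)"
  have m: "f m < t"
    unfolding m_def using \<open>f n < t\<close> by (rule LeastI)
  have "N < m"
  proof (rule ccontr)
    assume "\<not> N < m"
    then have "- int N \<le> - int m" by simp
    then have "(2 :: real) powi (- int N) \<le> 2 powi (- int m)"
      by (rule power_int_increasing) simp
    then have "f N \<le> f m"
      using \<open>0 < \<delta>\<close> by (simp add: f_def mult_right_mono)
    with m assms(2) show False
      by (simp add: f_def)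
  qed
  then obtain k where k: "m = Suc k"
    by (cases m) auto
  have "\<not> f k < t"
    by (rule not_less_Least) (simp add: m_def[symmetric] k)
  then have "t \<le> 2 * f m"
    using Suc[of k] k by simp
  with m \<open>N < m\<close> show thesis
    by (intro that[of m]) (auto simp: f_def)
qed

theorem theorem1p2:
  fixes E :: "(real ^ 'n) set" and p :: "real ^ 'n" and \<alpha> :: real
  assumes "1 < \<alpha>" and "\<alpha> \<le> real CARD('n)"
    and "thin_at \<alpha> E p"
  shows "\<exists>\<theta>\<in>sphere 0 1. \<exists>r>0. \<forall>t. 0 < t \<and> t < r \<longrightarrow> p + t *\<^sub>R \<theta> \<notin> E"
proof -
  obtain \<delta> where "0 < \<delta>" and thin: "(\<Sum>i. thinness_term \<alpha> E p \<delta> (Suc i)) < \<infinity>"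
    using assms(3) unfolding thin_at_def by blast
  obtain C where C: "\<And>i. 0 < i \<Longrightarrow>
      outer_measure_of lborel (cone_directions E p (2 powi (- int i) * \<delta>))
        \<le> ennreal C * thinness_term \<alpha> E p \<delta> i"
    using outer_measure_cone_directions_le_thinness_term[OF assms(1,2)] \<open>0 < \<delta>\<close> by metis
  \<comment> \<open>The sets of bad directions need not be measurable; they are enlarged to measurable sets of the
    same outer measure before the Borel--Cantelli lemma is applied.\<close>
  define A where "A i = cone_directions E p (2 powi (- int (Suc i)) * \<delta>)" for i
  have "\<exists>B\<in>sets lborel. A i \<subseteq> B \<and> outer_measure_of lborel (A i) = emeasure lborel B" for i
    by (rule outer_measure_of_attain) simp
  then obtain B where B [measurable]: "\<And>i. B i \<in> sets lborel"
    and AB: "\<And>i. A i \<subseteq> B i" "\<And>i. outer_measure_of lborel (A i) = emeasure lborel (B i)"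
    by metis
  have "(\<Sum>i. emeasure lborel (B i)) \<le> (\<Sum>i. ennreal C * thinness_term \<alpha> E p \<delta> (Suc i))"
    unfolding AB(2)[symmetric] A_def by (intro suminf_le C) auto
  also have "\<dots> < \<infinity>"
    using thin by (simp add: ennreal_mult_less_top)
  finally have sum: "(\<Sum>i. emeasure lborel (B i)) < \<infinity>" .
  have finite: "emeasure lborel (B i) < \<infinity>" for i
  proof -
    have "emeasure lborel (B i) = (\<Sum>j\<in>{i}. emeasure lborel (B j))"
      by simp
    also have "\<dots> \<le> (\<Sum>i. emeasure lborel (B i))"
      by (rule sum_le_suminf) auto
    finally show ?thesis
      using sum by (rule le_less_trans)
  qed
  have "summable (\<lambda>i. measure lborel (B i))"
  proof (rule summable_suminf_not_top)
    show "(\<Sum>i. ennreal (measure lborel (B i))) \<noteq> top"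
      using sum finite by (simp add: emeasure_eq_ennreal_measure[symmetric] less_top)
  qed simp
  then have bc: "AE x in lborel. eventually (\<lambda>i. x \<in> space lborel - B i) sequentially"
    using finite by (intro borel_cantelli_AE1 B)
  have nz: "AE x in lborel. x \<noteq> (0 :: real ^ 'n)"
    by (rule AE_lborel_singleton)
  have nball: "\<not> (AE x in lborel. x \<notin> ball (0 :: real ^ 'n) 1)"
  proof
    assume "AE x in lborel. x \<notin> ball (0 :: real ^ 'n) 1"
    then have "emeasure lborel (ball (0 :: real ^ 'n) 1) = 0"
      using AE_iff_null_sets[of "ball (0 :: real ^ 'n) 1" lborel] by (simp add: null_setsD1)
    then show False
      using emeasure_ball[of 1 "0 :: real ^ 'n"] unit_ball_vol_pos[of "real DIM(real ^ 'n)"]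
      by simp
  qed
  have "\<exists>x. x \<in> ball 0 1 \<and> x \<noteq> 0 \<and> eventually (\<lambda>i. x \<in> space lborel - B i) sequentially"
  proof (rule ccontr)
    assume "\<not> ?thesis"
    then have no: "x \<notin> ball 0 1" if "x \<noteq> 0" "eventually (\<lambda>i. x \<in> space lborel - B i) sequentially" for x
      using that by blast
    have "AE x in lborel. x \<notin> ball (0 :: real ^ 'n) 1"
      using bc nz by eventually_elim (rule no)
    with nball show False ..
  qed
  then obtain x where x: "x \<in> ball 0 1" "x \<noteq> 0"
    "eventually (\<lambda>i. x \<in> space lborel - B i) sequentially"
    by blast
  then obtain N where N: "\<And>i. N \<le> i \<Longrightarrow> x \<notin> B i"
    unfolding eventually_sequentially by blast
  have "p + t *\<^sub>R sgn x \<notin> E" if t: "0 < t" "t < 2 powi (- int N) * \<delta>" for t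
  proof
    assume E: "p + t *\<^sub>R sgn x \<in> E"
    obtain i where i: "N < i" "t \<in> {2 powi (- int i) * \<delta> .. 2 * (2 powi (- int i) * \<delta>)}"
      using dyadic_interval_exists[of t N \<delta>] t by auto
    then have "x \<in> cone_directions E p (2 powi (- int i) * \<delta>)"
      unfolding cone_directions_def using x(1,2) E by blast
    moreover obtain k where "i = Suc k"
      using i(1) by (cases i) auto
    ultimately have "x \<in> B k"
      using AB(1)[of k] by (auto simp: A_def)
    with N[of k] i(1) \<open>i = Suc k\<close> show False
      by simp
  qed
  moreover have "sgn x \<in> sphere 0 1"
    using x(2) by (simp add: norm_sgn)
  moreover have "0 < 2 powi (- int N) * \<delta>"
    using \<open>0 < \<delta>\<close> by simp
  ultimately show ?thesis
    by blast
qed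

end
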